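(* Consider the system $\dot x=yz,\ \dot y=xz,\ \dot z=z-xy$ on $\mathbb{R}^3$. Both the $x$-axis and the $y$-axis consist of fixed points. All other orbits tend to infinity for $t\to+\infty$.
   Context: An orbit tends to infinity if its Euclidean norm tends to $+\infty$. *)

theory Defs
  imports "HOL-Analysis.Analysis"
begin

definition solution_on ::
    "('a::real_normed_vector \<Rightarrow> 'a) \<Rightarrow> real set \<Rightarrow> (real \<Rightarrow> 'a) \<Rightarrow> bool" where
  "solution_on f I u \<longleftrightarrow>
     open I \<and> is_interval I \<and> I \<noteq> {} \<and>
     (\<forall>t\<in>I. (u has_vector_derivative f (u t)) (at t))"

text \<open>The values of \<open>u\<close> outside \<open>I\<close> are irrelevant. The time interval \<open>I\<close> of a maximal
  solution may a priori be bounded (blow-up in finite time).\<close>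

definition maximal_solution_on ::
    "('a::real_normed_vector \<Rightarrow> 'a) \<Rightarrow> real set \<Rightarrow> (real \<Rightarrow> 'a) \<Rightarrow> bool" where
  "maximal_solution_on f I u \<longleftrightarrow>
     solution_on f I u \<and>
     (\<forall>J v. solution_on f J v \<and> I \<subseteq> J \<and> (\<forall>t\<in>I. v t = u t) \<longrightarrow> J = I)"

definition fixed_point :: "('a::real_normed_vector \<Rightarrow> 'a) \<Rightarrow> 'a \<Rightarrow> bool" where
  "fixed_point f p \<longleftrightarrow> solution_on f UNIV (\<lambda>_. p)"

text \<open>An orbit is the image \<open>u ` I\<close> of a maximal solution. That it tends to infinity for
  \<open>t \<rightarrow> +\<infinity>\<close> includes that the solution exists for all large times, since \<open>u\<close> has no
  meaning outside \<open>I\<close>.\<close>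

definition tends_to_infinity_forward ::
    "real set \<Rightarrow> (real \<Rightarrow> 'a::real_normed_vector) \<Rightarrow> bool" where
  "tends_to_infinity_forward I u \<longleftrightarrow>
     (\<exists>a. {a..} \<subseteq> I) \<and> filterlim (\<lambda>t. norm (u t)) at_top at_top"

definition vector_field :: "real ^ 3 \<Rightarrow> real ^ 3" where
  "vector_field p = vector [p $ 2 * p $ 3, p $ 1 * p $ 3, p $ 3 - p $ 1 * p $ 2]"

definition x_axis :: "(real ^ 3) set" where
  "x_axis = {p. p $ 2 = 0 \<and> p $ 3 = 0}"

definition y_axis :: "(real ^ 3) set" where
  "y_axis = {p. p $ 1 = 0 \<and> p $ 3 = 0}"

end

(* The functions x^2 + z^2 and y^2 + z^2 both have derivative 2 z^2, so they are nondecreasing.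
   Their sum N satisfies N' = 4 z^2 <= 4 N, so solutions cannot blow up in finite time.
   If N stays bounded, Barbalat's lemma applied to x^2 + z^2 and then to z gives z -> 0 and
   z' -> 0, hence x y -> 0.  So one of the two nonnegative nondecreasing functions tends to 0,
   therefore vanishes identically, and the solution is a fixed point on an axis.  Otherwise the
   nondecreasing function N tends to infinity. *)

theory Submission
  imports Defs
begin

section \<open>Local existence and continuation of solutions\<close>

lemma lipschitz_on_if_vector_derivative_bounded:
  fixes u :: "real \<Rightarrow> 'a::real_normed_vector"
  assumes "convex S" and "0 \<le> B"
    and der: "\<And>t. t \<in> S \<Longrightarrow> (u has_vector_derivative u' t) (at t within S)"
    and bound: "\<And>t. t \<in> S \<Longrightarrow> norm (u' t) \<le> B"
  shows "B-lipschitz_on S u"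
proof (rule lipschitz_onI)
  fix s t assume "s \<in> S" "t \<in> S"
  then have "norm (u s - u t) \<le> B * norm (s - t)"
  proof (intro differentiable_bound[OF \<open>convex S\<close>])
    fix r assume "r \<in> S"
    then show "(u has_derivative (\<lambda>h. h *\<^sub>R u' r)) (at r within S)"
      using der by (simp add: has_vector_derivative_def)
    show "onorm (\<lambda>h. h *\<^sub>R u' r) \<le> B"
      using bound[OF \<open>r \<in> S\<close>] \<open>0 \<le> B\<close>
      by (intro onorm_le) (simp add: mult.commute[of B] mult_left_mono)
  qed auto
  then show "dist (u s) (u t) \<le> B * dist s t"
    by (simp add: dist_norm)
qed fact

text \<open>Picard iteration: on a short interval the integral operator is a contraction of a closed
  ball of bounded continuous functions, a complete space, and its fixed point solves the equation.
  The solution runs only to the right of \<open>b\<close>, since it serves to prolong an orbit past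
  its right end.\<close>

lemma picard_local_solution:
  fixes f :: "'a::banach \<Rightarrow> 'a" and b :: real
  assumes L: "L-lipschitz_on (cball p r) f" and "r > 0"
  obtains \<delta> w where "\<delta> > 0" "w b = p"
    "\<And>t. t \<in> {b..b + \<delta>} \<Longrightarrow> (w has_vector_derivative f (w t)) (at t within {b..b + \<delta>})"
proof -
  have "L \<ge> 0" using L by (rule lipschitz_on_nonneg)
  \<comment> \<open>A bound for \<open>norm (f q)\<close> on the ball; the summand 1 makes it
    positive, so that \<open>r / M\<close> is meaningful.\<close>
  define M where "M = norm (f p) + L * r + 1"
  have "M > 0" unfolding M_def using \<open>L \<ge> 0\<close> \<open>r > 0\<close>
    by (simp add: add_nonneg_pos)
  have M: "norm (f q) \<le> M" if "q \<in> cball p r" for q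
  proof -
    have "dist (f q) (f p) \<le> L * dist q p"
      using lipschitz_onD[OF L] that \<open>r > 0\<close> by simp
    also have "\<dots> \<le> L * r"
      using that \<open>L \<ge> 0\<close> by (simp add: dist_commute mult_left_mono)
    finally show ?thesis
      using norm_triangle_ineq2[of "f q" "f p"] by (simp add: M_def dist_norm)
  qed
  \<comment> \<open>The first entry keeps Picard iterates inside the ball, the second makes the
    contraction factor \<open>L * \<delta>\<close> at most 1/2; \<open>L + 1\<close> avoids dividing
    by zero when \<open>L = 0\<close>.\<close>
  define \<delta> where "\<delta> = min (r / M) (1 / (2 * (L + 1)))"
  have "\<delta> > 0" using \<open>M > 0\<close> \<open>L \<ge> 0\<close> \<open>r > 0\<close> by (simp add: \<delta>_def)
  have "M * \<delta> \<le> M * (r / M)" using \<open>M > 0\<close> by (intro mult_left_mono) (auto simp: \<delta>_def)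
  then have M\<delta>: "M * \<delta> \<le> r" using \<open>M > 0\<close> by simp
  have "L * \<delta> \<le> L * (1 / (2 * (L + 1)))" using \<open>L \<ge> 0\<close> by (intro mult_left_mono) (auto simp: \<delta>_def)
  also have "\<dots> \<le> 1 / 2" using \<open>L \<ge> 0\<close> by (simp add: divide_simps)
  finally have L\<delta>: "L * \<delta> \<le> 1 / 2" .

  \<comment> \<open>The Picard operator acts on functions on the whole line, constant outside \<open>{b..b + \<delta>}\<close>.\<close>
  define m where "m t = max b (min t (b + \<delta>))" for t :: real
  have m: "m t \<in> {b..b + \<delta>}" for t using \<open>\<delta> > 0\<close> by (auto simp: m_def)
  define P where "P \<phi> t = p + integral {b..m t} (\<lambda>s. f (apply_bcontfun \<phi> s))"
    for \<phi> :: "real \<Rightarrow>\<^sub>C 'a" and t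
  define S :: "(real \<Rightarrow>\<^sub>C 'a) set" where "S = cball (const_bcontfun p) r"
  have S_iff: "\<phi> \<in> S \<longleftrightarrow> (\<forall>t. apply_bcontfun \<phi> t \<in> cball p r)" for \<phi>
  proof
    show "\<phi> \<in> S" if "\<forall>t. apply_bcontfun \<phi> t \<in> cball p r"
      using that unfolding S_def mem_cball by (intro dist_bound) (simp add: const_bcontfun.rep_eq)
    show "\<forall>t. apply_bcontfun \<phi> t \<in> cball p r" if "\<phi> \<in> S"
      using that dist_bounded[of "const_bcontfun p" _ \<phi>] order_trans
      unfolding S_def mem_cball const_bcontfun.rep_eq by blast
  qed
  have cont_f: "continuous_on A (\<lambda>s. f (apply_bcontfun \<phi> s))" if "\<phi> \<in> S" for \<phi> A
    using that by (intro continuous_on_compose2[OF lipschitz_on_continuous_on[OF L]])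
      (auto simp: S_iff)
  have integrable: "(\<lambda>s. f (apply_bcontfun \<phi> s)) integrable_on {c..d}" if "\<phi> \<in> S" for \<phi> c d
    using cont_f[OF that] by (rule integrable_continuous_real)
  have cont_P: "continuous_on UNIV (P \<phi>)" if "\<phi> \<in> S" for \<phi>
    unfolding P_def
    by (intro continuous_on_add continuous_on_const
        continuous_on_compose2[OF indefinite_integral_continuous_1[OF integrable[OF that, of b "b + \<delta>"]]])
      (use m in \<open>auto simp: m_def intro!: continuous_intros\<close>)
  have P_ball: "P \<phi> t \<in> cball p r" if "\<phi> \<in> S" for \<phi> t
  proof -
    have "norm (integral {b..m t} (\<lambda>s. f (apply_bcontfun \<phi> s))) \<le> M * (m t - b)"
      using m[of t] that by (intro integral_bound cont_f M) (auto simp: S_iff)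
    also have "\<dots> \<le> M * \<delta>" using m[of t] \<open>M > 0\<close> by (intro mult_left_mono) auto
    finally show ?thesis using M\<delta> by (simp add: P_def dist_norm)
  qed
  have P_bcontfun: "P \<phi> \<in> bcontfun" if "\<phi> \<in> S" for \<phi>
  proof -
    have "range (P \<phi>) \<subseteq> cball p r" using P_ball[OF that] by blast
    then show ?thesis
      using cont_P[OF that] bounded_subset[OF bounded_cball] by (auto simp: bcontfun_def)
  qed
  \<comment> \<open>\<open>Bcontfun\<close> is meaningful only on bounded continuous functions;
    \<open>P_bcontfun\<close> guarantees this for arguments in \<open>S\<close>.\<close>
  define T where "T \<phi> = Bcontfun (P \<phi>)" for \<phi>
  have T: "apply_bcontfun (T \<phi>) = P \<phi>" if "\<phi> \<in> S" for \<phi>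
    unfolding T_def using P_bcontfun[OF that] by (rule Bcontfun_inverse)
  have "\<exists>!\<phi>. \<phi> \<in> S \<and> T \<phi> = \<phi>"
  proof (rule Banach_fix[of S "1/2"])
    show "complete S" by (simp add: S_def complete_eq_closed)
    show "S \<noteq> {}" using \<open>r > 0\<close> by (simp add: S_def)
    show "T ` S \<subseteq> S" using P_ball T by (auto simp: S_iff)
    fix \<phi> \<psi> assume \<phi>: "\<phi> \<in> S" and \<psi>: "\<psi> \<in> S"
    show "dist (T \<phi>) (T \<psi>) \<le> 1 / 2 * dist \<phi> \<psi>"
    proof (rule dist_bound)
      fix t
      have "P \<phi> t - P \<psi> t
          = integral {b..m t} (\<lambda>s. f (apply_bcontfun \<phi> s) - f (apply_bcontfun \<psi> s))"
        by (simp add: P_def integral_diff integrable \<phi> \<psi>)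
      also have "norm \<dots> \<le> (L * dist \<phi> \<psi>) * (m t - b)"
      proof (rule integral_bound)
        fix s
        have "dist (f (apply_bcontfun \<phi> s)) (f (apply_bcontfun \<psi> s))
            \<le> L * dist (apply_bcontfun \<phi> s) (apply_bcontfun \<psi> s)"
          using \<phi> \<psi> by (intro lipschitz_onD[OF L]) (auto simp: S_iff)
        also have "\<dots> \<le> L * dist \<phi> \<psi>"
          using \<open>L \<ge> 0\<close> dist_bounded by (intro mult_left_mono)
        finally show "norm (f (apply_bcontfun \<phi> s) - f (apply_bcontfun \<psi> s)) \<le> L * dist \<phi> \<psi>"
          by (simp add: dist_norm)
      qed (use m[of t] \<phi> \<psi> in \<open>auto intro!: continuous_on_diff cont_f\<close>)
      also have "\<dots> \<le> (L * dist \<phi> \<psi>) * \<delta>"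
        using m[of t] \<open>L \<ge> 0\<close> by (intro mult_left_mono) auto
      also have "\<dots> = (L * \<delta>) * dist \<phi> \<psi>" by simp
      also have "\<dots> \<le> 1 / 2 * dist \<phi> \<psi>" using L\<delta> by (intro mult_right_mono) auto
      finally show "dist (apply_bcontfun (T \<phi>) t) (apply_bcontfun (T \<psi>) t) \<le> 1 / 2 * dist \<phi> \<psi>"
        by (simp add: T \<phi> \<psi> dist_norm)
    qed
  qed auto
  then obtain \<phi> where \<phi>: "\<phi> \<in> S" "T \<phi> = \<phi>" by auto
  define w where "w = apply_bcontfun \<phi>"
  \<comment> \<open>On this interval the clamp \<open>m\<close> is the identity, so the fixed point
    equation is the integral form of the differential equation.\<close>
  have w: "w t = p + integral {b..t} (\<lambda>s. f (w s))" if "t \<in> {b..b + \<delta>}" for t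
  proof -
    have "m t = t" using that by (auto simp: m_def)
    moreover have "w = P \<phi>" using T[OF \<phi>(1)] \<phi>(2) by (simp add: w_def)
    ultimately show ?thesis unfolding P_def w_def by metis
  qed
  show ?thesis
  proof (rule that[of \<delta> w])
    show "w b = p" using w[of b] \<open>\<delta> > 0\<close> by simp
    fix t assume t: "t \<in> {b..b + \<delta>}"
    have "((\<lambda>t. integral {b..t} (\<lambda>s. f (w s))) has_vector_derivative f (w t))
        (at t within {b..b + \<delta>})"
      using cont_f[OF \<phi>(1)] t unfolding w_def by (rule integral_has_vector_derivative)
    then have "((\<lambda>t. p + integral {b..t} (\<lambda>s. f (w s))) has_vector_derivative f (w t))
        (at t within {b..b + \<delta>})"
      by (auto intro!: derivative_eq_intros)
    then show "(w has_vector_derivative f (w t)) (at t within {b..b + \<delta>})"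
      by (rule has_vector_derivative_transform[rotated 2]) (use t w in auto)
  qed fact
qed

text \<open>The fundamental theorem of calculus tolerates one exceptional point, so \<open>v\<close>
  is a constant plus the integral of the continuous function \<open>v'\<close>, and this integral is
  differentiable at \<open>c\<close> too.\<close>

lemma has_vector_derivative_removable_point:
  fixes v :: "real \<Rightarrow> 'a::banach"
  assumes cont: "continuous_on {a..d} v" "continuous_on {a..d} v'" and "a < c" "c < d"
    and der: "\<And>t. t \<in> {a<..<d} - {c} \<Longrightarrow> (v has_vector_derivative v' t) (at t)"
  shows "(v has_vector_derivative v' c) (at c)"
proof -
  have int: "integral {a..t} v' = v t - v a" if "t \<in> {a..d}" for t
    using that
    by (intro integral_unique fundamental_theorem_of_calculus_interior_strong[of "{c}"] der
        continuous_on_subset[OF cont(1)]) auto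
  have "((\<lambda>t. v a + integral {a..t} v') has_vector_derivative v' c) (at c within {a..d})"
    using integral_has_vector_derivative[OF cont(2), of c] \<open>a < c\<close> \<open>c < d\<close>
    by (auto intro!: derivative_eq_intros)
  then have "(v has_vector_derivative v' c) (at c within {a..d})"
    by (rule has_vector_derivative_transform[rotated 2]) (use int \<open>a < c\<close> \<open>c < d\<close> in auto)
  then show ?thesis
    using \<open>a < c\<close> \<open>c < d\<close> by (simp add: at_within_Icc_at)
qed

text \<open>If the interval ended at a finite time \<open>b\<close>, boundedness would bound the
  velocity, so \<open>u\<close> would have a limit at \<open>b\<close>; a Picard solution started
  from that limit would prolong \<open>u\<close> and contradict maximality.\<close>

lemma maximal_solution_extends_forward:
  fixes f :: "'a::euclidean_space \<Rightarrow> 'a"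
  assumes loc_lip: "\<And>p. \<exists>r>0. \<exists>L. L-lipschitz_on (cball p r) f"
    and max: "maximal_solution_on f I u"
    and "t0 \<in> I"
    and bounded: "\<And>b. bounded (u ` (I \<inter> {t0..b}))"
  shows "{t0..} \<subseteq> I"
proof (rule ccontr)
  assume "\<not> {t0..} \<subseteq> I"
  then obtain s where s: "t0 \<le> s" "s \<notin> I" by auto
  have "open I" and interval: "is_interval I"
    and der: "\<And>t. t \<in> I \<Longrightarrow> (u has_vector_derivative f (u t)) (at t)"
    using max by (auto simp: maximal_solution_on_def solution_on_def)
  have I_less_s: "t < s" if "t \<in> I" for t
    using interval s \<open>t0 \<in> I\<close> that unfolding is_interval_1 by (meson not_less)
  define b where "b = Sup I"
  have bdd: "bdd_above I" using I_less_s by (meson bdd_aboveI less_imp_le)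
  \<comment> \<open>Openness of \<open>I\<close> leaves room to the right of each of its points, so
    the supremum is not attained.\<close>
  have I_less_b: "t < b" if "t \<in> I" for t
  proof -
    obtain e where "e > 0" "cball t e \<subseteq> I"
      using \<open>open I\<close> \<open>t \<in> I\<close> open_contains_cball by blast
    then have "t + e \<in> I" by (auto simp: dist_real_def subset_iff)
    then have "t + e \<le> b" unfolding b_def using bdd by (rule cSup_upper)
    with \<open>e > 0\<close> show ?thesis by simp
  qed
  have "t0 < b" using I_less_b \<open>t0 \<in> I\<close> .
  have sub: "{t0..<b} \<subseteq> I"
  proof
    fix t assume t: "t \<in> {t0..<b}"
    then obtain t1 where "t1 \<in> I" "t < t1"
      using less_cSup_iff[OF _ bdd] \<open>t0 \<in> I\<close> unfolding b_def by auto
    then show "t \<in> I"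
      using t interval \<open>t0 \<in> I\<close> unfolding is_interval_1 by (meson atLeastLessThan_iff less_imp_le)
  qed

  have "continuous_on (cball p r) f" if "L-lipschitz_on (cball p r) f" for p r L
    using that by (rule lipschitz_on_continuous_on)
  then have "isCont f p" for p
    using loc_lip[of p] continuous_on_interior[of "cball p _" f p]
    by (metis centre_in_ball interior_cball)
  then have cont_f: "continuous_on A f" for A
    by (simp add: continuous_at_imp_continuous_on)
  have "bounded (f ` u ` {t0..<b})"
  proof (rule bounded_subset)
    \<comment> \<open>In a Euclidean space the closure of a bounded set is compact, and a continuous
      image of it is bounded.\<close>
    show "bounded (f ` closure (u ` (I \<inter> {t0..b})))"
      using bounded[of b] cont_f
      by (intro compact_imp_bounded compact_continuous_image) (simp_all add: compact_closure)
    show "f ` u ` {t0..<b} \<subseteq> f ` closure (u ` (I \<inter> {t0..b}))"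
      using sub by (intro image_mono subset_trans[OF _ closure_subset]) auto
  qed
  then obtain B where B: "B > 0" "\<And>t. t \<in> {t0..<b} \<Longrightarrow> norm (f (u t)) \<le> B"
    unfolding bounded_pos by auto
  have "B-lipschitz_on {t0..<b} u"
    using B sub by (intro lipschitz_on_if_vector_derivative_bounded[where u' = "\<lambda>t. f (u t)"])
      (auto intro!: has_vector_derivative_at_within[OF der])
  then have "uniformly_continuous_on {t0..<b} u" by (rule lipschitz_on_uniformly_continuous)
  \<comment> \<open>Uniform continuity extends \<open>u\<close> to the endpoint: \<open>g b\<close>
    is the left limit of \<open>u\<close> at \<open>b\<close> and the initial value for the
    prolongation.\<close>
  then obtain g where "uniformly_continuous_on (closure {t0..<b}) g"
    and gu: "\<And>t. t \<in> {t0..<b} \<Longrightarrow> u t = g t"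
    by (rule uniformly_continuous_on_extension_on_closure) blast
  then have cont_g: "continuous_on {t0..b} g"
    using \<open>t0 < b\<close> by (simp add: uniformly_continuous_imp_continuous)

  obtain r L where "r > 0" "L-lipschitz_on (cball (g b) r) f" using loc_lip by blast
  then obtain \<delta> w where \<delta>: "\<delta> > 0" and wb: "w b = g b"
    and w: "\<And>t. t \<in> {b..b + \<delta>} \<Longrightarrow> (w has_vector_derivative f (w t)) (at t within {b..b + \<delta>})"
    using picard_local_solution[of L "g b" r f b] by blast
  define v where "v t = (if t < b then u t else w t)" for t
  define J where "J = I \<union> {t0<..<b + \<delta>}"
  have cont_v: "continuous_on {t0..b + \<delta>} v"
  proof -
    have "continuous_on {b..b + \<delta>} w"
      using w by (meson continuous_on_eq_continuous_within has_vector_derivative_continuous)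
    then have "continuous_on ({t0..b} \<union> {b..b + \<delta>}) (\<lambda>t. if t \<le> b then g t else w t)"
      using cont_g wb by (intro continuous_on_If) auto
    moreover have "{t0..b} \<union> {b..b + \<delta>} = {t0..b + \<delta>}" using \<open>t0 < b\<close> \<delta> by auto
    ultimately have "continuous_on {t0..b + \<delta>} (\<lambda>t. if t \<le> b then g t else w t)" by simp
    then show ?thesis
      by (rule continuous_on_eq) (auto simp: v_def gu wb)
  qed
  have v_off_b: "(v has_vector_derivative f (v t)) (at t)" if "t \<in> J" "t \<noteq> b" for t
  proof (cases "t < b")
    case True
    then have "t \<in> I" using that sub by (auto simp: J_def)
    have "(v has_vector_derivative f (u t)) (at t)"
      by (rule has_vector_derivative_transform_within_open[OF der[OF \<open>t \<in> I\<close>], of "{..<b}"])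
        (use True in \<open>auto simp: v_def\<close>)
    then show ?thesis using True by (simp add: v_def)
  next
    case False
    then have t: "t \<in> {b<..<b + \<delta>}" using that I_less_b[of t] by (auto simp: J_def)
    then have "(w has_vector_derivative f (w t)) (at t)"
      using w[of t] by (simp add: at_within_Icc_at)
    then have "(v has_vector_derivative f (w t)) (at t)"
      by (rule has_vector_derivative_transform_within_open[of _ _ _ "{b<..}"])
        (use t in \<open>auto simp: v_def\<close>)
    then show ?thesis using t by (simp add: v_def)
  qed
  \<comment> \<open>At the gluing time the derivative follows from continuity of \<open>v\<close>,
    and hence of \<open>f\<close> along \<open>v\<close>, and from the equation on both
    sides.\<close>
  have v_at_b: "(v has_vector_derivative f (v b)) (at b)"
  proof (rule has_vector_derivative_removable_point[of t0 "b + \<delta>"])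
    show "continuous_on {t0..b + \<delta>} (\<lambda>t. f (v t))"
      using cont_f[of UNIV] cont_v by (rule continuous_on_compose2) auto
  qed (use cont_v \<open>t0 < b\<close> \<delta> v_off_b in \<open>auto simp: J_def\<close>)
  have "solution_on f J v"
    unfolding solution_on_def
  proof (intro conjI ballI)
    show "open J" using \<open>open I\<close> unfolding J_def by (intro open_Un) auto
    \<comment> \<open>A common point of the two intervals makes their union connected.\<close>
    have "(t0 + b) / 2 \<in> I \<inter> {t0<..<b + \<delta>}"
      using \<open>t0 < b\<close> \<delta> sub by (auto simp: field_simps subset_iff)
    then show "is_interval J"
      unfolding J_def is_interval_connected_1 using interval
      by (intro connected_Un) (auto simp: is_interval_connected_1)
    show "J \<noteq> {}" using \<open>t0 \<in> I\<close> by (auto simp: J_def)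
    fix t assume "t \<in> J"
    then show "(v has_vector_derivative f (v t)) (at t)"
      using v_off_b v_at_b by (cases "t = b") auto
  qed
  moreover have "I \<subseteq> J" by (simp add: J_def)
  moreover have "\<forall>t\<in>I. v t = u t" using I_less_b by (simp add: v_def)
  ultimately have "J = I" using max by (auto simp: maximal_solution_on_def)
  moreover have "b \<in> J" using \<open>t0 < b\<close> \<delta> by (auto simp: J_def)
  ultimately show False using I_less_b by blast
qed


section \<open>Limits of real functions at infinity\<close>

text \<open>Increments of the convergent \<open>g\<close> over windows of fixed length
  \<open>d\<close> tend to 0. By the mean value theorem \<open>g'\<close> is small somewhere in each
  late window, and the Lipschitz bound carries this to the left end of the window.\<close>

lemma barbalat:
  fixes g g' :: "real \<Rightarrow> real"
  assumes lim: "(g \<longlongrightarrow> l) at_top"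
    and der: "\<And>t. t \<ge> a \<Longrightarrow> (g has_real_derivative g' t) (at t)"
    and lip: "L-lipschitz_on {a..} g'"
  shows "(g' \<longlongrightarrow> 0) at_top"
proof (rule tendstoI)
  fix e :: real assume "e > 0"
  have "L \<ge> 0" using lip by (rule lipschitz_on_nonneg)
  \<comment> \<open>The window is short enough for \<open>g'\<close> to vary by at most
    \<open>e / 2\<close> on it. The tolerance \<open>d * (e / 2)\<close> below leaves the other half
    of \<open>e\<close> after division by \<open>d\<close>.\<close>
  define d where "d = e / (2 * (L + 1))"
  have "d > 0" using \<open>e > 0\<close> \<open>L \<ge> 0\<close> by (simp add: d_def)
  have Ld: "L * d \<le> e / 2" using \<open>e > 0\<close> \<open>L \<ge> 0\<close> by (simp add: d_def divide_simps)
  have "((\<lambda>t. g (t + d) - g t) \<longlongrightarrow> l - l) at_top"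
    by (intro tendsto_diff lim filterlim_compose[OF lim]
        filterlim_at_top_mono[OF filterlim_ident]) (use \<open>d > 0\<close> in auto)
  then have "\<forall>\<^sub>F t in at_top. dist (g (t + d) - g t) 0 < d * (e / 2)"
    using \<open>d > 0\<close> \<open>e > 0\<close> by (intro tendstoD) auto
  then show "\<forall>\<^sub>F t in at_top. dist (g' t) 0 < e"
    using eventually_ge_at_top[of a]
  proof eventually_elim
    case (elim t)
    obtain s where s: "t < s" "s < t + d" "g (t + d) - g t = (t + d - t) * g' s"
      using MVT2[of t "t + d" g g'] der elim(2) \<open>d > 0\<close> by auto
    then have "d * \<bar>g' s\<bar> < d * (e / 2)"
      using elim(1) \<open>d > 0\<close> by (simp add: abs_mult)
    then have "\<bar>g' s\<bar> < e / 2" using \<open>d > 0\<close> by simp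
    moreover have "\<bar>g' t - g' s\<bar> \<le> L * \<bar>t - s\<bar>"
      using lipschitz_onD[OF lip, of t s] elim(2) s(1) by (simp add: dist_real_def)
    moreover have "L * \<bar>t - s\<bar> \<le> L * d"
      using s \<open>L \<ge> 0\<close> by (intro mult_left_mono) auto
    ultimately show ?case using Ld by simp
  qed
qed

lemma nondecreasing_bounded_tendsto:
  fixes g :: "real \<Rightarrow> real"
  assumes mono: "\<And>s t. a \<le> s \<Longrightarrow> s \<le> t \<Longrightarrow> g s \<le> g t"
    and bound: "\<And>t. a \<le> t \<Longrightarrow> g t \<le> B"
  obtains l where "(g \<longlongrightarrow> l) at_top"
proof
  have bdd: "bdd_above (g ` {a..})" using bound by (auto intro!: bdd_aboveI)
  show "(g \<longlongrightarrow> Sup (g ` {a..})) at_top"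
  proof (rule increasing_tendsto)
    show "\<forall>\<^sub>F t in at_top. g t \<le> Sup (g ` {a..})"
      using eventually_ge_at_top[of a] by eventually_elim (auto intro: cSup_upper bdd)
    fix c assume "c < Sup (g ` {a..})"
    then obtain s where "s \<ge> a" "c < g s"
      using less_cSup_iff[OF _ bdd] by auto
    show "\<forall>\<^sub>F t in at_top. c < g t"
      using eventually_ge_at_top[of s]
    proof eventually_elim
      case (elim t)
      then show ?case using mono[of s t] \<open>s \<ge> a\<close> \<open>c < g s\<close> by simp
    qed
  qed
qed

section \<open>Lipschitz bounds and components of the vector field\<close>

lemma vector_field_lipschitz:
  assumes "R \<ge> 0"
  shows "(6 * R + 1)-lipschitz_on (cball 0 R) vector_field"
proof (rule lipschitz_onI)
  fix p q :: "real ^ 3" assume "p \<in> cball 0 R" "q \<in> cball 0 R"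
  then have R: "\<bar>p $ i\<bar> \<le> R" "\<bar>q $ i\<bar> \<le> R" for i
    using component_le_norm_cart[of p i] component_le_norm_cart[of q i] by auto
  have d: "\<bar>p $ i - q $ i\<bar> \<le> norm (p - q)" for i
    using component_le_norm_cart[of "p - q" i] by simp
  have prod: "\<bar>p $ i * p $ j - q $ i * q $ j\<bar> \<le> 2 * R * norm (p - q)" for i j
  proof -
    have "p $ i * p $ j - q $ i * q $ j = p $ i * (p $ j - q $ j) + (p $ i - q $ i) * q $ j"
      by (simp add: algebra_simps)
    also have "\<bar>\<dots>\<bar> \<le> R * norm (p - q) + norm (p - q) * R"
      using R d \<open>R \<ge> 0\<close>
      by (intro order_trans[OF abs_triangle_ineq] add_mono) (auto simp: abs_mult intro!: mult_mono)
    finally show ?thesis by (simp add: algebra_simps)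
  qed
  have "norm (vector_field p - vector_field q)
      \<le> (\<Sum>i\<in>UNIV. \<bar>(vector_field p - vector_field q) $ i\<bar>)"
    by (rule norm_le_l1_cart)
  \<comment> \<open>Each of the three quadratic terms contributes \<open>2 * R\<close>, and the
    linear term of the third component contributes 1.\<close>
  also have "\<dots> \<le> (6 * R + 1) * norm (p - q)"
    using prod[of 2 3] prod[of 1 3] prod[of 1 2] d[of 3]
    by (simp add: sum_3 vector_field_def algebra_simps)
  finally show "dist (vector_field p) (vector_field q) \<le> (6 * R + 1) * dist p q"
    by (simp add: dist_norm)
qed (use assms in simp)

lemma vector_field_locally_lipschitz: "\<exists>r>0. \<exists>L. L-lipschitz_on (cball p r) vector_field"
proof -
  have "cball p 1 \<subseteq> cball 0 (norm p + 1)"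
  proof
    fix q assume "q \<in> cball p 1"
    then show "q \<in> cball 0 (norm p + 1)"
      using norm_triangle_sub[of q p] by (simp add: dist_norm norm_minus_commute)
  qed
  then have "(6 * (norm p + 1) + 1)-lipschitz_on (cball p 1) vector_field"
    by (intro lipschitz_on_subset[OF vector_field_lipschitz]) auto
  then show ?thesis by (intro exI[of _ 1]) auto
qed

lemma vector_derivative_components:
  assumes "(u has_vector_derivative vector_field (u t)) (at t)"
  shows "((\<lambda>t. u t $ 1) has_real_derivative u t $ 2 * u t $ 3) (at t)"
    and "((\<lambda>t. u t $ 2) has_real_derivative u t $ 1 * u t $ 3) (at t)"
    and "((\<lambda>t. u t $ 3) has_real_derivative u t $ 3 - u t $ 1 * u t $ 2) (at t)"
proof -
  have "((\<lambda>t. u t $ i) has_real_derivative vector_field (u t) $ i) (at t)" for i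
    using bounded_linear.has_vector_derivative[OF bounded_linear_vec_nth assms]
    by (simp add: has_real_derivative_iff_has_vector_derivative)
  from this[of 1] this[of 2] this[of 3] show
    "((\<lambda>t. u t $ 1) has_real_derivative u t $ 2 * u t $ 3) (at t)"
    "((\<lambda>t. u t $ 2) has_real_derivative u t $ 1 * u t $ 3) (at t)"
    "((\<lambda>t. u t $ 3) has_real_derivative u t $ 3 - u t $ 1 * u t $ 2) (at t)"
    by (simp_all add: vector_field_def)
qed

section \<open>Monotone quantities along an orbit\<close>

text \<open>The system in scalar coordinates. Its symmetry under exchanging \<open>x\<close> and
  \<open>y\<close> lets each fact about \<open>x\<close> be reused for \<open>y\<close> through
  \<open>swap\<close>.\<close>

locale orbit =
  fixes I :: "real set" and x y z :: "real \<Rightarrow> real"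
  assumes interval: "is_interval I"
    and dx: "\<And>t. t \<in> I \<Longrightarrow> (x has_real_derivative y t * z t) (at t)"
    and dy: "\<And>t. t \<in> I \<Longrightarrow> (y has_real_derivative x t * z t) (at t)"
    and dz: "\<And>t. t \<in> I \<Longrightarrow> (z has_real_derivative z t - x t * y t) (at t)"
begin

text \<open>The contributions \<open>2 * x t * y t * z t\<close> of the two squares have opposite
  signs and cancel.\<close>

lemma dx2z2: "t \<in> I \<Longrightarrow> ((\<lambda>t. (x t)\<^sup>2 + (z t)\<^sup>2) has_real_derivative 2 * (z t)\<^sup>2) (at t)"
  by (auto intro!: derivative_eq_intros dx dz simp: power2_eq_square algebra_simps)

lemma x2z2_mono:
  assumes "s \<in> I" "t \<in> I" "s \<le> t"
  shows "(x s)\<^sup>2 + (z s)\<^sup>2 \<le> (x t)\<^sup>2 + (z t)\<^sup>2"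
  using \<open>s \<le> t\<close>
proof (rule DERIV_nonneg_imp_nondecreasing)
  fix r assume "s \<le> r" "r \<le> t"
  then have "r \<in> I" using interval assms unfolding is_interval_1 by blast
  then show "\<exists>d. ((\<lambda>t. (x t)\<^sup>2 + (z t)\<^sup>2) has_real_derivative d) (at r) \<and> 0 \<le> d"
    using dx2z2 by (intro exI[of _ "2 * (z r)\<^sup>2"]) auto
qed

text \<open>A nondecreasing function lies below its limit, so this sum of squares is at most 0 at
  every time of \<open>I\<close>, including times before \<open>t0\<close>.\<close>

lemma x2z2_zero_if_tendsto_zero:
  assumes "{t0..} \<subseteq> I" and lim: "((\<lambda>t. (x t)\<^sup>2 + (z t)\<^sup>2) \<longlongrightarrow> 0) at_top" and "t \<in> I"
  shows "x t = 0 \<and> z t = 0"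
proof -
  have "\<forall>\<^sub>F s in at_top. (x t)\<^sup>2 + (z t)\<^sup>2 \<le> (x s)\<^sup>2 + (z s)\<^sup>2"
    using eventually_ge_at_top[of "max t0 t"]
    by eventually_elim (use assms in \<open>auto intro!: x2z2_mono\<close>)
  with lim have "(x t)\<^sup>2 + (z t)\<^sup>2 \<le> 0"
    by (rule tendsto_lowerbound) simp
  then show ?thesis by (simp add: sum_power2_le_zero_iff)
qed

lemma swap: "orbit I y x z"
  by standard (use interval dx dy dz in \<open>auto simp: mult.commute\<close>)

lemma bounded_imp_stationary:
  assumes sub: "{t0..} \<subseteq> I"
    and bound: "\<And>t. t \<ge> t0 \<Longrightarrow> \<bar>x t\<bar> \<le> K \<and> \<bar>y t\<bar> \<le> K \<and> \<bar>z t\<bar> \<le> K"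
  shows "(\<forall>t\<in>I. x t = 0 \<and> z t = 0) \<or> (\<forall>t\<in>I. y t = 0 \<and> z t = 0)"
proof -
  interpret swapped: orbit I y x z by (rule swap)
  have "K \<ge> 0" using bound[of t0] by linarith
  have sq: "(w t)\<^sup>2 \<le> K\<^sup>2" if "\<bar>w t\<bar> \<le> K" for w :: "real \<Rightarrow> real" and t
    using that \<open>K \<ge> 0\<close> by (metis abs_le_square_iff abs_of_nonneg)
  obtain l where l: "((\<lambda>t. (x t)\<^sup>2 + (z t)\<^sup>2) \<longlongrightarrow> l) at_top"
    by (rule nondecreasing_bounded_tendsto[of t0 "\<lambda>t. (x t)\<^sup>2 + (z t)\<^sup>2" "K\<^sup>2 + K\<^sup>2"])
      (use sub in \<open>intro x2z2_mono add_mono sq; auto simp: bound subset_iff\<close>)+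
  obtain m where m: "((\<lambda>t. (y t)\<^sup>2 + (z t)\<^sup>2) \<longlongrightarrow> m) at_top"
    by (rule nondecreasing_bounded_tendsto[of t0 "\<lambda>t. (y t)\<^sup>2 + (z t)\<^sup>2" "K\<^sup>2 + K\<^sup>2"])
      (use sub in \<open>intro swapped.x2z2_mono add_mono sq; auto simp: bound subset_iff\<close>)+
  have xy: "\<bar>x t * y t\<bar> \<le> K * K" and dz_bound: "\<bar>z t - x t * y t\<bar> \<le> K + K * K" if "t \<ge> t0" for t
  proof -
    show *: "\<bar>x t * y t\<bar> \<le> K * K"
      unfolding abs_mult using bound[OF that] by (intro mult_mono) auto
    show "\<bar>z t - x t * y t\<bar> \<le> K + K * K"
      using * bound[OF that] by linarith
  qed

  have "((\<lambda>t. 2 * (z t)\<^sup>2) \<longlongrightarrow> 0) at_top"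
  proof (rule barbalat[OF l])
    \<comment> \<open>The derivative is four times \<open>z\<close> times its velocity; these two
      factors are bounded by \<open>K\<close> and \<open>K + K * K\<close>.\<close>
    show "(4 * (K * (K + K * K)))-lipschitz_on {t0..} (\<lambda>t. 2 * (z t)\<^sup>2)"
    proof (rule lipschitz_on_if_vector_derivative_bounded)
      fix t assume t: "t \<in> {t0..}"
      then have "((\<lambda>t. 2 * (z t)\<^sup>2) has_real_derivative 4 * (z t * (z t - x t * y t))) (at t)"
        using sub by (auto intro!: derivative_eq_intros dz)
      then show "((\<lambda>t. 2 * (z t)\<^sup>2) has_vector_derivative 4 * (z t * (z t - x t * y t)))
          (at t within {t0..})"
        unfolding has_real_derivative_iff_has_vector_derivative
        by (rule has_vector_derivative_at_within)
      have "\<bar>z t\<bar> * \<bar>z t - x t * y t\<bar> \<le> K * (K + K * K)"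
        using bound dz_bound t \<open>K \<ge> 0\<close> by (intro mult_mono) auto
      then show "norm (4 * (z t * (z t - x t * y t))) \<le> 4 * (K * (K + K * K))"
        by (simp add: abs_mult)
    qed (use \<open>K \<ge> 0\<close> in auto)
  qed (use sub dx2z2 in auto)
  from tendsto_mult_left[OF this, of "1 / 2"] have z2: "((\<lambda>t. (z t)\<^sup>2) \<longlongrightarrow> 0) at_top"
    by simp
  then have z: "(z \<longlongrightarrow> 0) at_top"
    using tendsto_real_sqrt[OF z2] by (simp add: tendsto_rabs_zero_iff)

  have "((\<lambda>t. z t - x t * y t) \<longlongrightarrow> 0) at_top"
  proof (rule barbalat[OF z])
    \<comment> \<open>The constant bounds the second derivative of \<open>z\<close>, which is the
      velocity of \<open>z\<close> minus
      \<open>((x t)\<^sup>2 + (y t)\<^sup>2) * z t\<close>.\<close>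
    show "(K + K * K + (K\<^sup>2 + K\<^sup>2) * K)-lipschitz_on {t0..} (\<lambda>t. z t - x t * y t)"
    proof (rule lipschitz_on_if_vector_derivative_bounded)
      fix t assume t: "t \<in> {t0..}"
      then have "((\<lambda>t. z t - x t * y t) has_real_derivative
          z t - x t * y t - ((x t)\<^sup>2 + (y t)\<^sup>2) * z t) (at t)"
        using sub
        by (auto intro!: derivative_eq_intros dx dy dz simp: power2_eq_square algebra_simps)
      then show "((\<lambda>t. z t - x t * y t) has_vector_derivative
          z t - x t * y t - ((x t)\<^sup>2 + (y t)\<^sup>2) * z t) (at t within {t0..})"
        unfolding has_real_derivative_iff_has_vector_derivative
        by (rule has_vector_derivative_at_within)
      have "\<bar>((x t)\<^sup>2 + (y t)\<^sup>2) * z t\<bar> \<le> (K\<^sup>2 + K\<^sup>2) * K"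
        unfolding abs_mult using bound[of t] t sq[of x t] sq[of y t]
        by (intro mult_mono) auto
      then show "norm (z t - x t * y t - ((x t)\<^sup>2 + (y t)\<^sup>2) * z t) \<le> K + K * K + (K\<^sup>2 + K\<^sup>2) * K"
        using dz_bound[of t] t by (simp add: abs_if split: if_splits)
    qed (use \<open>K \<ge> 0\<close> in auto)
  qed (use sub dz in auto)
  \<comment> \<open>The product \<open>x t * y t\<close> is \<open>z\<close> minus its velocity, and
    both tend to 0.\<close>
  from tendsto_diff[OF z this] have "((\<lambda>t. (x t * y t)\<^sup>2) \<longlongrightarrow> 0\<^sup>2) at_top"
    by (intro tendsto_power) simp
  \<comment> \<open>Removing the vanishing \<open>z\<close> square from the two monotone sums shows
    that the squares of \<open>x\<close> and \<open>y\<close> tend to \<open>l\<close> and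
    \<open>m\<close>; uniqueness of limits then forces \<open>l * m = 0\<close>.\<close>
  moreover have "((\<lambda>t. (x t * y t)\<^sup>2) \<longlongrightarrow> (l - 0) * (m - 0)) at_top"
    using tendsto_mult[OF tendsto_diff[OF l z2] tendsto_diff[OF m z2]]
    by (simp add: power_mult_distrib)
  ultimately have "(l - 0) * (m - 0) = 0\<^sup>2"
    by (metis tendsto_unique trivial_limit_at_top_linorder)
  then have "l = 0 \<or> m = 0" by simp
  then show ?thesis
    using x2z2_zero_if_tendsto_zero[OF sub] swapped.x2z2_zero_if_tendsto_zero[OF sub] l m by blast
qed

text \<open>The weight 2 makes this the sum of the two monotone functions; it lies between the
  squared norm and twice the squared norm.\<close>

definition N where "N t = (x t)\<^sup>2 + (y t)\<^sup>2 + 2 * (z t)\<^sup>2"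

lemma N_mono: "s \<in> I \<Longrightarrow> t \<in> I \<Longrightarrow> s \<le> t \<Longrightarrow> N s \<le> N t"
  using x2z2_mono[of s t] orbit.x2z2_mono[OF swap, of s t] by (simp add: N_def)

lemma dN: "t \<in> I \<Longrightarrow> (N has_real_derivative 4 * (z t)\<^sup>2) (at t)"
  unfolding N_def
  by (auto intro!: derivative_eq_intros dx dy dz simp: power2_eq_square algebra_simps)

text \<open>A Gronwall estimate: the derivative of \<open>N\<close> is at most four times
  \<open>N\<close>, so \<open>N t * exp (- 4 * t)\<close> is nonincreasing.\<close>

lemma N_growth:
  assumes "s \<in> I" "t \<in> I" "s \<le> t"
  shows "N t \<le> N s * exp (4 * (t - s))"
proof -
  have "N t * exp (- 4 * t) \<le> N s * exp (- 4 * s)"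
    using \<open>s \<le> t\<close>
  proof (rule DERIV_nonpos_imp_nonincreasing)
    fix r assume "s \<le> r" "r \<le> t"
    then have "r \<in> I" using interval assms unfolding is_interval_1 by blast
    then have "((\<lambda>t. N t * exp (- 4 * t)) has_real_derivative
        (4 * (z r)\<^sup>2 - 4 * N r) * exp (- 4 * r)) (at r)"
      by (auto intro!: derivative_eq_intros dN simp: algebra_simps)
    moreover have "(4 * (z r)\<^sup>2 - 4 * N r) * exp (- 4 * r) \<le> 0"
    proof (rule mult_nonpos_nonneg)
      show "4 * (z r)\<^sup>2 - 4 * N r \<le> 0"
      proof -
        have "N r = (z r)\<^sup>2 + ((x r)\<^sup>2 + (y r)\<^sup>2 + (z r)\<^sup>2)"
          by (simp add: N_def)
        then have "(z r)\<^sup>2 \<le> N r" by (simp add: add_nonneg_nonneg)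
        then show ?thesis by simp
      qed
    qed simp
    ultimately show "\<exists>d. ((\<lambda>t. N t * exp (- 4 * t)) has_real_derivative d) (at r) \<and> d \<le> 0"
      by blast
  qed
  then have "N t * exp (- 4 * t) * exp (4 * t) \<le> N s * exp (- 4 * s) * exp (4 * t)"
    by (intro mult_right_mono) auto
  then show ?thesis by (simp add: mult.assoc algebra_simps flip: exp_add)
qed

end

section \<open>Fixed points and divergence of all other orbits\<close>

lemma norm_vec3_squared: "(norm (p :: real ^ 3))\<^sup>2 = (p $ 1)\<^sup>2 + (p $ 2)\<^sup>2 + (p $ 3)\<^sup>2"
  by (simp add: norm_vec_def L2_set_def sum_3 sum_nonneg)

theorem mainTheorem6:
  shows "(\<forall>p \<in> x_axis \<union> y_axis. fixed_point vector_field p) \<and>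
    (\<forall>I u. maximal_solution_on vector_field I u \<and>
        \<not> (\<exists>p \<in> x_axis \<union> y_axis. u ` I = {p}) \<longrightarrow>
      tends_to_infinity_forward I u)"
proof (intro conjI ballI allI impI; (elim conjE)?)
  have zero: "vector_field p = 0" if "p \<in> x_axis \<union> y_axis" for p
    using that by (auto simp: vector_field_def x_axis_def y_axis_def vec_eq_iff forall_3)
  show "fixed_point vector_field p" if "p \<in> x_axis \<union> y_axis" for p
    using zero[OF that] by (simp add: fixed_point_def solution_on_def)

  fix I u
  assume max: "maximal_solution_on vector_field I u"
    and not_fixed: "\<not> (\<exists>p \<in> x_axis \<union> y_axis. u ` I = {p})"
  then have interval: "is_interval I" and "I \<noteq> {}"
    and der: "\<And>t. t \<in> I \<Longrightarrow> (u has_vector_derivative vector_field (u t)) (at t)"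
    by (auto simp: maximal_solution_on_def solution_on_def)
  from \<open>I \<noteq> {}\<close> obtain t0 where "t0 \<in> I" by auto
  interpret orbit I "\<lambda>t. u t $ 1" "\<lambda>t. u t $ 2" "\<lambda>t. u t $ 3"
    by standard (use interval vector_derivative_components[OF der] in auto)
  have norm_le_N: "(norm (u t))\<^sup>2 \<le> N t" and N_le_norm: "N t \<le> 2 * (norm (u t))\<^sup>2" for t
    by (simp_all add: norm_vec3_squared N_def)

  have sub: "{t0..} \<subseteq> I"
  proof (rule maximal_solution_extends_forward[OF vector_field_locally_lipschitz max \<open>t0 \<in> I\<close>])
    fix b
    \<comment> \<open>At most exponential growth of \<open>N\<close> bounds the orbit on bounded
      time intervals, which rules out forward blow-up in finite time.\<close>
    have "norm (u t) \<le> sqrt (N t0 * exp (4 * (b - t0)))" if "t \<in> I \<inter> {t0..b}" for t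
    proof (rule real_le_rsqrt)
      have "N t \<le> N t0 * exp (4 * (t - t0))"
        using that \<open>t0 \<in> I\<close> by (intro N_growth) auto
      also have "\<dots> \<le> N t0 * exp (4 * (b - t0))"
        using that by (intro mult_left_mono) (auto simp: N_def)
      finally show "(norm (u t))\<^sup>2 \<le> N t0 * exp (4 * (b - t0))"
        using norm_le_N by (rule order_trans[rotated])
    qed
    then show "bounded (u ` (I \<inter> {t0..b}))" unfolding bounded_iff by blast
  qed

  have unbounded: "\<exists>t\<ge>t0. B < N t" for B
  proof (rule ccontr)
    assume "\<not> (\<exists>t\<ge>t0. B < N t)"
    then have "N t \<le> B" if "t \<ge> t0" for t using that by (meson not_less)
    then have "norm (u t) \<le> sqrt B" if "t \<ge> t0" for t
      using norm_le_N that by (meson real_le_rsqrt order_trans)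
    then have "\<bar>u t $ i\<bar> \<le> sqrt B" if "t \<ge> t0" for t i
      using component_le_norm_cart that by (meson order_trans)
    then have "(\<forall>t\<in>I. u t $ 1 = 0 \<and> u t $ 3 = 0) \<or> (\<forall>t\<in>I. u t $ 2 = 0 \<and> u t $ 3 = 0)"
      by (intro bounded_imp_stationary[OF sub]) auto
    then have on_axes: "u t \<in> x_axis \<union> y_axis" if "t \<in> I" for t
      using that by (auto simp: x_axis_def y_axis_def)
    \<comment> \<open>Lying on an axis is weaker than being a single point; the field vanishes
      there, so \<open>u\<close> is constant on the interval \<open>I\<close>.\<close>
    have "(u has_vector_derivative 0) (at t within I)" if "t \<in> I" for t
      using der[OF that] zero[OF on_axes[OF that]] by (simp add: has_vector_derivative_at_within)
    then obtain p where "\<And>t. t \<in> I \<Longrightarrow> u t = p"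
      using has_vector_derivative_zero_constant[of I u] interval is_interval_convex by blast
    then have "u ` I = {u t0}" using \<open>t0 \<in> I\<close> by auto
    then show False using not_fixed on_axes[OF \<open>t0 \<in> I\<close>] by blast
  qed
  have "filterlim (\<lambda>t. norm (u t)) at_top at_top"
    unfolding filterlim_at_top
  proof
    fix Z :: real
    \<comment> \<open>The factor 2 matches \<open>N_le_norm\<close>. Monotonicity of
      \<open>N\<close> turns this single time into a bound for all later times.\<close>
    obtain s where s: "s \<ge> t0" "2 * Z\<^sup>2 < N s" using unbounded by blast
    show "\<forall>\<^sub>F t in at_top. Z \<le> norm (u t)"
      using eventually_ge_at_top[of s]
    proof eventually_elim
      case (elim t)
      then have "N s \<le> N t" using s sub by (intro N_mono) auto
      then have "Z\<^sup>2 \<le> (norm (u t))\<^sup>2" using s(2) N_le_norm[of t] by linarith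
      then show ?case by (rule power2_le_imp_le) simp
    qed
  qed
  then show "tends_to_infinity_forward I u"
    using sub by (auto simp: tends_to_infinity_forward_def)
qed

end
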